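(* Let $r\geqslant 3$ and let $H$ be an $r$-uniform hypergraph on $n$ vertices with vertex set $[n]=\{1,2,\ldots,n\}$. For $i\in[n]$ let $d_i$ be the degree of vertex $i$ in $H$, and let $\rho(H)$ be the spectral radius of $H$, i.e. the spectral radius of the adjacency tensor $\mathcal{A}(H)$. Then $$\rho(H)\geqslant\left(\frac{1}{n}\sum_{i=1}^n d_i^{\frac{r}{r-1}}\right)^{\frac{r-1}{r}}.$$ Moreover, if $H$ is connected, then equality holds if and only if $H$ is regular.
   Context: A hypergraph $H=(V,E)$ consists of a finite set $V$ of vertices and a set $E$ of non-empty subsets of $V$, called edges. It is $r$-uniform if every edge has exactly $r$ elements. The degree $d_i$ of a vertex $i$ is the number of edges containing $i$; $H$ is regular if all vertices have the same degree. A walk is an alternating sequence of vertices and edges $i_1e_1i_2e_2\cdots i_\ell e_\ell i_{\ell+1}$ with $\{i_j,i_{j+1}\}\subseteq e_j\in E$ for $1\leqslant j\leqslant \ell$; $H$ is connected if for any vertices $i,j$ there is a walk connecting $i$ and $j$. A real tensor of order $r$ and dimension $n$ is an array $\mathcal{T}=(t_{i_1i_2\cdots i_r})$ of real numbers indexed by $i_1,\ldots,i_r\in[n]$. For $\boldsymbol{x}=(x_1,\ldots,x_n)^{\mathrm{T}}\in\mathbb{C}^n$, $\mathcal{T}\boldsymbol{x}\in\mathbb{C}^n$ is the vector with components $(\mathcal{T}\boldsymbol{x})_i=\sum_{i_2,\ldots,i_r=1}^n t_{ii_2\cdots i_r}x_{i_2}\cdots x_{i_r}$, and $\boldsymbol{x}^{[r-1]}=(x_1^{r-1},\ldots,x_n^{r-1})^{\mathrm{T}}$.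 A number $\lambda\in\mathbb{C}$ is an eigenvalue of $\mathcal{T}$ if there is a nonzero $\boldsymbol{x}\in\mathbb{C}^n$ with $\mathcal{T}\boldsymbol{x}=\lambda\boldsymbol{x}^{[r-1]}$. The spectral radius $\rho(\mathcal{T})$ is the maximum modulus of the eigenvalues of $\mathcal{T}$. The adjacency tensor of an $r$-uniform hypergraph $H$ with vertex set $[n]$ is the order $r$, dimension $n$ tensor $\mathcal{A}(H)=(a_{i_1i_2\cdots i_r})$ with $a_{i_1i_2\cdots i_r}=\frac{1}{(r-1)!}$ if $\{i_1,i_2,\ldots,i_r\}\in E(H)$, and $a_{i_1i_2\cdots i_r}=0$ otherwise. One writes $\rho(H)=\rho(\mathcal{A}(H))$. *)

theory Defs
  imports Complex_Main
begin

definition hypergraph :: "'a set \<Rightarrow> 'a set set \<Rightarrow> bool" where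
  "hypergraph V E \<longleftrightarrow> finite V \<and> (\<forall>e\<in>E. e \<noteq> {} \<and> e \<subseteq> V)"

definition uniform_hypergraph :: "nat \<Rightarrow> 'a set \<Rightarrow> 'a set set \<Rightarrow> bool" where
  "uniform_hypergraph r V E \<longleftrightarrow> hypergraph V E \<and> (\<forall>e\<in>E. card e = r)"

definition hyperdegree :: "'a set set \<Rightarrow> 'a \<Rightarrow> nat" where
  "hyperdegree E i = card {e \<in> E. i \<in> e}"

definition regular_hypergraph :: "'a set \<Rightarrow> 'a set set \<Rightarrow> bool" where
  "regular_hypergraph V E \<longleftrightarrow> (\<forall>i\<in>V. \<forall>j\<in>V. hyperdegree E i = hyperdegree E j)"

text \<open>
  A walk \<open>i\<^sub>1 e\<^sub>1 i\<^sub>2 e\<^sub>2 \<dots> e\<^sub>l i\<^sub>l\<^sub>+\<^sub>1\<close> is given by its list \<open>vs\<close> of vertices and its list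
  \<open>es\<close> of edges.  The walk of length \<open>0\<close> is allowed, so a single vertex without
  edges is connected.
\<close>

definition hyperwalk :: "'a set \<Rightarrow> 'a set set \<Rightarrow> 'a list \<Rightarrow> 'a set list \<Rightarrow> bool" where
  "hyperwalk V E vs es \<longleftrightarrow>
     set vs \<subseteq> V \<and> length vs = Suc (length es) \<and>
     (\<forall>j < length es. es ! j \<in> E \<and> {vs ! j, vs ! Suc j} \<subseteq> es ! j)"

definition connected_hypergraph :: "'a set \<Rightarrow> 'a set set \<Rightarrow> bool" where
  "connected_hypergraph V E \<longleftrightarrow>
     (\<forall>i\<in>V. \<forall>j\<in>V. \<exists>vs es. hyperwalk V E vs es \<and> hd vs = i \<and> last vs = j)"

text \<open>
  A real tensor of order \<open>r\<close> and dimension \<open>n\<close> is a function on index lists, of which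
  only the values on lists of length \<open>r\<close> with entries in \<open>{1..n}\<close> are used.
  Likewise a vector in \<open>\<complex>\<^sup>n\<close> is a function of which only the values on \<open>{1..n}\<close> are used.
\<close>

type_synonym tensor = "nat list \<Rightarrow> real"

definition tensor_apply :: "nat \<Rightarrow> nat \<Rightarrow> tensor \<Rightarrow> (nat \<Rightarrow> complex) \<Rightarrow> nat \<Rightarrow> complex" where
  "tensor_apply r n T x i =
     (\<Sum>js\<in>{js. set js \<subseteq> {1..n} \<and> length js = r - 1}.
        complex_of_real (T (i # js)) * (\<Prod>j\<leftarrow>js. x j))"

definition tensor_eigenvalue :: "nat \<Rightarrow> nat \<Rightarrow> tensor \<Rightarrow> complex \<Rightarrow> bool" where
  "tensor_eigenvalue r n T \<mu> \<longleftrightarrow>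
     (\<exists>x. (\<exists>i\<in>{1..n}. x i \<noteq> 0) \<and>
          (\<forall>i\<in>{1..n}. tensor_apply r n T x i = \<mu> * x i ^ (r - 1)))"

definition tensor_spectral_radius :: "nat \<Rightarrow> nat \<Rightarrow> tensor \<Rightarrow> real" where
  "tensor_spectral_radius r n T =
     (GREATEST m. \<exists>\<mu>. tensor_eigenvalue r n T \<mu> \<and> m = cmod \<mu>)"

definition adjacency_tensor :: "nat \<Rightarrow> nat set set \<Rightarrow> tensor" where
  "adjacency_tensor r E js = (if set js \<in> E then 1 / fact (r - 1) else 0)"

definition hypergraph_spectral_radius :: "nat \<Rightarrow> nat \<Rightarrow> nat set set \<Rightarrow> real" where
  "hypergraph_spectral_radius r n E = tensor_spectral_radius r n (adjacency_tensor r E)"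

end

theory Submission
  imports Defs "HOL-Analysis.Analysis" "HOL-Combinatorics.Multiset_Permutations"
begin

text \<open>
  Write \<open>P x\<close> for the sum over all edges \<open>e\<close> of the products of the \<open>x\<^sub>j\<close>, \<open>j \<in> e\<close>.  The spectral
  radius is the maximum of \<open>r P x\<close> over the nonnegative part of the \<open>\<ell>\<^sup>r\<close> unit sphere: a maximizer is an
  eigenvector, and the triangle inequality bounds every other eigenvalue by this maximum.

  With \<open>w\<^sub>i\<close> proportional to \<open>d\<^sub>i\<close> to the power \<open>1 / (r - 1)\<close> and normalized to have \<open>\<ell>\<^sup>r\<close> norm \<open>n\<close> to
  the power \<open>1 / r\<close>, the lower bound comes from the test vector \<open>x\<^sub>i\<close> with
  \<open>x\<^sub>i\<^sup>r = w\<^sub>i\<^sup>r + (r - 1)\<close>, since a Hoelder inequality makes the product of \<open>x\<close> over an edge at least the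
  sum of \<open>w\<close> over it.  Equality forces \<open>x\<close>, hence the degree, to be constant on every edge.
\<close>

section \<open>AM-GM and Hoelder inequalities with their equality cases\<close>

text \<open>For positive \<open>t\<close> the gap \<open>t - 1 - ln t\<close> is nonnegative and
  vanishes only at \<open>t = 1\<close>. At \<open>t = b i ^ r / M\<close>, with \<open>M\<close>
  the mean of the \<open>b i ^ r\<close>, the gaps add up to
  \<open>r * (ln M - ln (prod b S))\<close>. This gives AM-GM, and equality makes every
  \<open>b i ^ r\<close> equal to \<open>M\<close>.\<close>

lemma card_times_prod_le_sum_power:
  fixes b :: "'a \<Rightarrow> real"
  assumes "finite S" and "S \<noteq> {}" and nn: "\<And>i. i \<in> S \<Longrightarrow> b i \<ge> 0"
  shows "card S * (\<Prod>i\<in>S. b i) \<le> (\<Sum>i\<in>S. b i ^ card S)"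
    and "card S * (\<Prod>i\<in>S. b i) = (\<Sum>i\<in>S. b i ^ card S) \<Longrightarrow> i \<in> S \<Longrightarrow> j \<in> S \<Longrightarrow> b i = b j"
proof -
  define r where "r = card S"
  have r: "r > 0" unfolding r_def using assms by (simp add: card_gt_0_iff)
  define s where "s = (\<Sum>i\<in>S. b i ^ r)"
  \<comment> \<open>A zero entry, where logarithms fail, is split off. Equality then makes all
    entries zero, which fits the common value \<open>root r (s / r)\<close> as well.\<close>
  have "r * prod b S \<le> s \<and> (r * prod b S = s \<longrightarrow> (\<forall>i\<in>S. b i = root r (s / r)))"
  proof (cases "\<exists>i\<in>S. b i = 0")
    case True
    then have p: "prod b S = 0" using assms by (simp add: prod_zero_iff)
    have "s \<ge> 0" unfolding s_def using nn by (intro sum_nonneg) auto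
    moreover have "b i = 0" if "s = 0" "i \<in> S" for i
      using that nn assms(1) r unfolding s_def by (subst (asm) sum_nonneg_eq_0_iff) auto
    ultimately show ?thesis using p r by auto
  next
    case False
    then have pos: "b i > 0" if "i \<in> S" for i using nn[OF that] that by force
    have s: "s > 0" unfolding s_def using pos assms by (intro sum_pos) auto
    define M where "M = s / r"
    have M: "M > 0" using s r by (simp add: M_def)
    define g where "g = (\<lambda>i. b i ^ r / M - 1 - ln (b i ^ r / M))"
    have g0: "g i \<ge> 0" if "i \<in> S" for i
      using ln_le_minus_one[of "b i ^ r / M"] pos[OF that] M by (simp add: g_def)
    have ln_pr: "ln (prod b S) = (\<Sum>i\<in>S. ln (b i))"
      using assms(1) by (intro ln_prod less_imp_neq[OF pos, symmetric])
    have "g i = b i ^ r / M - 1 - (r * ln (b i) - ln M)" if "i \<in> S" for i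
      using pos[OF that] M by (simp add: g_def ln_div ln_realpow)
    then have "sum g S = s / M - r - (\<Sum>i\<in>S. r * ln (b i) - ln M)"
      by (simp add: sum_subtractf s_def sum_divide_distrib r_def)
    also have "\<dots> = r * ln M - r * ln (prod b S)"
      using r s by (simp add: M_def sum_subtractf ln_pr r_def flip: sum_distrib_left)
    finally have sg: "sum g S = r * (ln M - ln (prod b S))" by (simp add: algebra_simps)
    have pp: "prod b S > 0" using pos by (intro prod_pos) auto
    have "sum g S \<ge> 0" using g0 by (intro sum_nonneg)
    then have "ln (prod b S) \<le> ln M" using sg r by (simp add: zero_le_mult_iff)
    then have "prod b S \<le> M" using pp M by simp
    then have "r * prod b S \<le> s" using r by (simp add: M_def field_simps)
    moreover have "b i = root r M" if "r * prod b S = s" "i \<in> S" for i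
    proof -
      have "prod b S = M" using that r by (simp add: M_def field_simps)
      then have "sum g S = 0" using sg by simp
      then have "g i = 0" using g0 assms(1) that(2) by (subst (asm) sum_nonneg_eq_0_iff) auto
      then have "b i ^ r / M = 1"
        using ln_eq_minus_one[of "b i ^ r / M"] pos[OF that(2)] M by (simp add: g_def)
      then show ?thesis
        using M r pos[OF that(2)] by (metis divide_eq_1_iff less_imp_le real_root_power_cancel)
    qed
    ultimately show ?thesis by (auto simp: M_def)
  qed
  then show "card S * (\<Prod>i\<in>S. b i) \<le> (\<Sum>i\<in>S. b i ^ card S)"
    and "card S * (\<Prod>i\<in>S. b i) = (\<Sum>i\<in>S. b i ^ card S) \<Longrightarrow> i \<in> S \<Longrightarrow> j \<in> S \<Longrightarrow> b i = b j"
    unfolding r_def s_def by (blast, metis)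
qed

text \<open>
  Hoelder's inequality for the square matrix with \<open>w\<close> on the diagonal and \<open>1\<close> elsewhere: divide row
  \<open>j\<close> by \<open>x\<^sub>j\<close>, apply AM-GM to each column, and add up.
\<close>

lemma sum_le_prod_root:
  fixes w :: "'a \<Rightarrow> real"
  assumes e: "finite e" "card e \<ge> 2" and w: "\<And>k. k \<in> e \<Longrightarrow> w k \<ge> 0"
    and x: "\<And>k. k \<in> e \<Longrightarrow> x k = root (card e) (w k ^ card e + real (card e - 1))"
  shows "(\<Sum>k\<in>e. w k) \<le> (\<Prod>j\<in>e. x j)"
    and "(\<Sum>k\<in>e. w k) = (\<Prod>j\<in>e. x j) \<Longrightarrow> card e \<ge> 3 \<Longrightarrow> i \<in> e \<Longrightarrow> j \<in> e \<Longrightarrow> x i = x j"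
proof -
  define r where "r = card e"
  have r: "r \<ge> 2" using e r_def by simp
  have ne: "e \<noteq> {}" using e by auto
  have xr: "x k ^ r = w k ^ r + real (r - 1)" if "k \<in> e" for k
    using x[OF that] w[OF that] r by (simp add: r_def)
  have xp: "x k > 0" if "k \<in> e" for k
  proof -
    have "0 < w k ^ r + real (r - 1)" using w[OF that] r by (intro add_nonneg_pos) auto
    then show ?thesis using x[OF that] r by (simp add: r_def)
  qed
  define b where "b = (\<lambda>k j. (if j = k then w k else 1) / x j)"
  have b0: "b k j \<ge> 0" if "j \<in> e" for k j
    using xp[OF that] w[OF that] by (auto simp: b_def)
  define p where "p = (\<Prod>j\<in>e. x j)"
  have p: "p > 0" unfolding p_def using xp by (intro prod_pos) auto
  have pb: "(\<Prod>j\<in>e. b k j) = w k / p" if "k \<in> e" for k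
    using that e(1) by (simp add: b_def p_def prod_dividef)
  have amgm: "r * (w k / p) \<le> (\<Sum>j\<in>e. b k j ^ r)" if "k \<in> e" for k
    using card_times_prod_le_sum_power(1)[OF e(1) ne, of "b k"] b0 pb[OF that] by (simp add: r_def)
  have "(\<Sum>k\<in>e. \<Sum>j\<in>e. b k j ^ r) = (\<Sum>j\<in>e. \<Sum>k\<in>e. b k j ^ r)" by (rule sum.swap)
  \<comment> \<open>Row \<open>j\<close> contributes exactly 1: \<open>x j ^ r\<close> is the sum
    \<open>w j ^ r + (r - 1)\<close> of the \<open>r\<close>-th powers in the undivided row.\<close>
  also have "\<dots> = (\<Sum>j\<in>e. 1)"
  proof (rule sum.cong[OF refl])
    fix j assume j: "j \<in> e"
    have "(\<Sum>k\<in>e. b k j ^ r) = (\<Sum>k\<in>e. (if k = j then w k ^ r else 1) / x j ^ r)"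
      by (intro sum.cong) (auto simp: b_def power_divide)
    also have "\<dots> = (\<Sum>k\<in>e. if k = j then w k ^ r else 1) / x j ^ r"
      by (simp add: sum_divide_distrib)
    also have "(\<Sum>k\<in>e. if k = j then w k ^ r else 1) = w j ^ r + real (r - 1)"
      using j e(1) by (subst sum.remove[OF e(1) j]) (auto simp: r_def)
    finally show "(\<Sum>k\<in>e. b k j ^ r) = 1" unfolding xr[OF j, symmetric] using xp[OF j] by simp
  qed
  finally have tot: "(\<Sum>k\<in>e. \<Sum>j\<in>e. b k j ^ r) = r" by (simp add: r_def)
  have lhs: "(\<Sum>k\<in>e. r * (w k / p)) = r * (sum w e / p)"
    by (simp add: sum_distrib_left sum_divide_distrib)
  have "(\<Sum>k\<in>e. r * (w k / p)) \<le> (\<Sum>k\<in>e. \<Sum>j\<in>e. b k j ^ r)"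
    by (rule sum_mono) (rule amgm)
  then have "r * (sum w e / p) \<le> r" unfolding lhs tot .
  then show "(\<Sum>k\<in>e. w k) \<le> (\<Prod>j\<in>e. x j)"
    using r p by (simp add: p_def[symmetric] field_simps)
  show "x i = x j" if eq: "(\<Sum>k\<in>e. w k) = (\<Prod>j\<in>e. x j)" and c3: "card e \<ge> 3" and i: "i \<in> e" and j: "j \<in> e"
  proof -
    \<comment> \<open>Equality of the totals makes AM-GM tight in each single column.\<close>
    have "(\<Sum>k\<in>e. r * (w k / p)) = (\<Sum>k\<in>e. \<Sum>j\<in>e. b k j ^ r)"
      using lhs tot eq p by (simp add: p_def)
    then have teq: "r * (w k / p) = (\<Sum>j\<in>e. b k j ^ r)" if "k \<in> e" for k
      by (rule sum_mono_inv[OF _ amgm that e(1)])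
    have "card {i, j} \<le> 2" by (simp add: card_insert_if)
    then have "\<not> e \<subseteq> {i, j}" using c3 card_mono[of "{i, j}" e] by auto
    \<comment> \<open>Column \<open>k\<close> has the entries \<open>1 / x\<^sub>i\<close> and \<open>1 / x\<^sub>j\<close>; its AM-GM is tight.\<close>
    then obtain k where k: "k \<in> e" "k \<noteq> i" "k \<noteq> j" by auto
    have "b k i = b k j"
      using card_times_prod_le_sum_power(2)[OF e(1) ne, of "b k" i j] b0 pb[OF k(1)] teq[OF k(1)] i j
      by (simp add: r_def)
    then show ?thesis using k xp[OF i] xp[OF j] by (auto simp: b_def)
  qed
qed

section \<open>The edge polynomial and the action of the adjacency tensor\<close>

definition edge_form :: "'a set set \<Rightarrow> ('a \<Rightarrow> 'b::comm_semiring_1) \<Rightarrow> 'b" where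
  "edge_form E x = (\<Sum>e\<in>E. \<Prod>j\<in>e. x j)"

text \<open>This is the partial derivative of \<open>edge_form\<close> in the coordinate
  \<open>i\<close>. Both forms are polymorphic because eigenvectors are complex while the
  maximization runs over real vectors.\<close>

definition link_form :: "'a set set \<Rightarrow> ('a \<Rightarrow> 'b::comm_semiring_1) \<Rightarrow> 'a \<Rightarrow> 'b" where
  "link_form E x i = (\<Sum>e | e \<in> E \<and> i \<in> e. \<Prod>j\<in>e - {i}. x j)"

lemma uniform_hypergraphD:
  assumes "uniform_hypergraph r V E"
  shows "finite V" "finite E" "e \<in> E \<Longrightarrow> finite e" "e \<in> E \<Longrightarrow> e \<subseteq> V" "e \<in> E \<Longrightarrow> card e = r"
    "e \<in> E \<Longrightarrow> e \<noteq> {}"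
proof -
  show V: "finite V" and s: "e \<in> E \<Longrightarrow> e \<subseteq> V" and "e \<in> E \<Longrightarrow> card e = r" "e \<in> E \<Longrightarrow> e \<noteq> {}" for e
    using assms by (auto simp: uniform_hypergraph_def hypergraph_def)
  show "finite E" using s V by (meson Pow_iff finite_Pow_iff finite_subset subsetI)
  show "e \<in> E \<Longrightarrow> finite e" using s V finite_subset by blast
qed

text \<open>A list of \<open>r - 1\<close> indices that forms an edge together with \<open>i\<close>
  has no repetition and avoids \<open>i\<close>, since the edge has \<open>r\<close> elements. So
  each edge \<open>e\<close> through \<open>i\<close> arises from the \<open>(r - 1)!\<close>
  orderings of \<open>e - {i}\<close>, which cancel the factor
  \<open>1 / fact (r - 1)\<close>.\<close>

lemma tensor_apply_adjacency:
  assumes u: "uniform_hypergraph r {1..n} E"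
  shows "tensor_apply r n (adjacency_tensor r E) x i = link_form E x i"
proof -
  note U = uniform_hypergraphD[OF u]
  let ?L = "{js. set js \<subseteq> {1..n} \<and> length js = r - 1}"
  let ?Ei = "{e \<in> E. i \<in> e}"
  let ?f = "\<lambda>js. complex_of_real (adjacency_tensor r E (i # js)) * (\<Prod>j\<leftarrow>js. x j)"
  have finL: "finite ?L" by (rule finite_lists_length_eq) simp
  have eq: "{js \<in> ?L. insert i (set js) \<in> E} = (\<Union>e\<in>?Ei. permutations_of_set (e - {i}))"
  proof (intro set_eqI iffI)
    fix js assume "js \<in> {js \<in> ?L. insert i (set js) \<in> E}"
    then have l: "length js = r - 1" and e: "insert i (set js) \<in> E" by auto
    have c: "card (insert i (set js)) = r" using U(5) e by blast
    moreover have "card (set js) \<le> r - 1" using card_length[of js] l by simp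
    moreover have "r > 0" using c by (metis card_gt_0_iff finite_insert finite_set insert_not_empty)
    ultimately have "i \<notin> set js" "card (set js) = r - 1"
      by (auto simp: card_insert_if split: if_splits)
    then have "js \<in> permutations_of_set (insert i (set js) - {i})"
      using l by (auto simp: permutations_of_set_def card_distinct)
    then show "js \<in> (\<Union>e\<in>?Ei. permutations_of_set (e - {i}))" using e by blast
  next
    fix js assume "js \<in> (\<Union>e\<in>?Ei. permutations_of_set (e - {i}))"
    then obtain e where e: "e \<in> E" "i \<in> e" and js: "set js = e - {i}" "distinct js"
      by (auto simp: permutations_of_set_def)
    have "length js = r - 1"
      using js e U(3,5)[OF e(1)] by (metis card_Diff_singleton distinct_card)
    then show "js \<in> {js \<in> ?L. insert i (set js) \<in> E}"
      using js e U(4)[OF e(1)] by (auto simp: insert_absorb)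
  qed
  have "tensor_apply r n (adjacency_tensor r E) x i = sum ?f ?L"
    by (simp add: tensor_apply_def)
  also have "\<dots> = sum ?f {js \<in> ?L. insert i (set js) \<in> E}"
    using finL by (intro sum.mono_neutral_right) (auto simp: adjacency_tensor_def)
  also have "\<dots> = (\<Sum>e\<in>?Ei. sum ?f (permutations_of_set (e - {i})))"
    unfolding eq
  proof (rule sum.UNION_disjoint)
    \<comment> \<open>The vertex \<open>i\<close> and the list determine the edge as
      \<open>insert i (set js)\<close>.\<close>
    show "\<forall>e\<in>?Ei. \<forall>e'\<in>?Ei. e \<noteq> e' \<longrightarrow>
        permutations_of_set (e - {i}) \<inter> permutations_of_set (e' - {i}) = {}"
      by (auto simp: permutations_of_set_def)
  qed (use U(2) in auto)
  also have "\<dots> = (\<Sum>e\<in>?Ei. \<Prod>j\<in>e - {i}. x j)"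
  proof (rule sum.cong[OF refl])
    fix e assume e: "e \<in> ?Ei"
    have "sum ?f (permutations_of_set (e - {i})) =
        (\<Sum>js\<in>permutations_of_set (e - {i}). 1 / fact (r - 1) * (\<Prod>j\<in>e - {i}. x j))"
    proof (rule sum.cong[OF refl])
      fix js assume js: "js \<in> permutations_of_set (e - {i})"
      then have "(\<Prod>j\<leftarrow>js. x j) = (\<Prod>j\<in>e - {i}. x j)"
        by (metis permutations_of_setD prod.distinct_set_conv_list)
      moreover have "insert i (set js) \<in> E"
        using permutations_of_setD(1)[OF js] e by (simp add: insert_absorb)
      ultimately show "?f js = 1 / fact (r - 1) * (\<Prod>j\<in>e - {i}. x j)"
        by (simp add: adjacency_tensor_def)
    qed
    also have "\<dots> = (\<Prod>j\<in>e - {i}. x j)"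
      using e U(3,5) by simp
    finally show "sum ?f (permutations_of_set (e - {i})) = (\<Prod>j\<in>e - {i}. x j)" .
  qed
  finally show ?thesis by (simp add: link_form_def)
qed

lemma sum_incident_edges:
  fixes f :: "'a \<Rightarrow> 'a set \<Rightarrow> 'b::comm_monoid_add"
  assumes "uniform_hypergraph r V E"
  shows "(\<Sum>i\<in>V. \<Sum>e | e \<in> E \<and> i \<in> e. f i e) = (\<Sum>e\<in>E. \<Sum>i\<in>e. f i e)"
proof -
  note U = uniform_hypergraphD[OF assms]
  have "{i \<in> V. i \<in> e} = e" if "e \<in> E" for e using U(4)[OF that] by auto
  then show ?thesis by (subst sum.swap_restrict[OF U(1,2)]) simp
qed

lemma sum_degree:
  fixes f :: "'a \<Rightarrow> real"
  assumes "uniform_hypergraph r V E"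
  shows "(\<Sum>i\<in>V. hyperdegree E i * f i) = (\<Sum>e\<in>E. \<Sum>i\<in>e. f i)"
  using sum_incident_edges[OF assms, of "\<lambda>i e. f i"] by (simp add: hyperdegree_def)

lemma mult_link_form:
  assumes "uniform_hypergraph r V E"
  shows "y i * link_form E y i = (\<Sum>e | e \<in> E \<and> i \<in> e. \<Prod>j\<in>e. y j)"
  unfolding link_form_def sum_distrib_left
  using uniform_hypergraphD(3)[OF assms] by (intro sum.cong refl) (auto simp: prod.remove)

text \<open>Euler's identity for a homogeneous polynomial of degree \<open>r\<close>: each edge
  product is counted once for each of the \<open>r\<close> vertices of the edge.\<close>

lemma sum_mult_link_form:
  fixes y :: "'a \<Rightarrow> real"
  assumes "uniform_hypergraph r V E"
  shows "(\<Sum>i\<in>V. y i * link_form E y i) = r * edge_form E y"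
  using sum_incident_edges[OF assms, of "\<lambda>i e. \<Prod>j\<in>e. y j"] uniform_hypergraphD(5)[OF assms]
  by (simp add: mult_link_form[OF assms] edge_form_def sum_distrib_left)

text \<open>A vertex occurs at most once in an edge product, so the dependence on one coordinate is
  affine with slope \<open>link_form\<close>.\<close>

lemma edge_form_upd:
  fixes y :: "'a \<Rightarrow> real"
  assumes "uniform_hypergraph r V E"
  shows "edge_form E (y(i := t)) = edge_form E y + (t - y i) * link_form E y i"
proof -
  note U = uniform_hypergraphD[OF assms]
  have split: "edge_form E z = (\<Sum>e | e \<in> E \<and> i \<notin> e. \<Prod>j\<in>e. z j) + z i * link_form E z i"
    for z :: "'a \<Rightarrow> real"
  proof -
    have "edge_form E z = (\<Sum>e\<in>E - {e\<in>E. i \<in> e}. \<Prod>j\<in>e. z j) + (\<Sum>e | e \<in> E \<and> i \<in> e. \<Prod>j\<in>e. z j)"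
      unfolding edge_form_def by (rule sum.subset_diff) (use U(2) in auto)
    moreover have "E - {e\<in>E. i \<in> e} = {e \<in> E. i \<notin> e}" by auto
    ultimately show ?thesis by (simp add: mult_link_form[OF assms])
  qed
  have "link_form E (y(i := t)) i = link_form E y i"
    unfolding link_form_def by (intro sum.cong prod.cong refl) auto
  moreover have "(\<Sum>e | e \<in> E \<and> i \<notin> e. \<Prod>j\<in>e. (y(i := t)) j) = (\<Sum>e | e \<in> E \<and> i \<notin> e. \<Prod>j\<in>e. y j)"
    by (intro sum.cong prod.cong refl) auto
  ultimately show ?thesis
    using split[of y] split[of "y(i := t)"] by (simp only: fun_upd_same left_diff_distrib)
qed

section \<open>The spectral radius as a constrained maximum\<close>

text \<open>
  \<open>edge_form\<close> is affine in each coordinate, so maximality in one coordinate takes the form assumed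
  here.  When \<open>x = 0\<close> only one-sided variations are available.
\<close>

lemma eigen_equation_of_min:
  fixes \<rho> x b :: real
  assumes r: "r \<ge> 2" and "x \<ge> 0" "b \<ge> 0"
    and min: "\<And>t. t \<ge> 0 \<Longrightarrow> real r * b * (t - x) \<le> \<rho> * (t ^ r - x ^ r)"
  shows "b = \<rho> * x ^ (r - 1)"
proof (cases "x = 0")
  case True
  \<comment> \<open>Dividing \<open>min\<close> by \<open>r * t\<close> and letting \<open>t\<close>
    tend to 0 from the right leaves this bound.\<close>
  have "b \<le> 0"
  proof (rule tendsto_lowerbound)
    have "((\<lambda>t. \<rho> * t ^ (r - 1) / r) \<longlongrightarrow> \<rho> * 0 ^ (r - 1) / r) (at_right 0)"
      by (intro tendsto_intros) (use r in auto)
    then show "((\<lambda>t. \<rho> * t ^ (r - 1) / r) \<longlongrightarrow> 0) (at_right 0)" using r by (simp add: zero_power)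
    show "\<forall>\<^sub>F t in at_right 0. b \<le> \<rho> * t ^ (r - 1) / r"
      unfolding eventually_at_right_field
    proof (intro exI[of _ 1] conjI allI impI)
      fix t :: real assume t: "0 < t" "t < 1"
      have "real r * b * t \<le> \<rho> * t ^ r" using min[of t] t True r by (simp add: power_0_left)
      also have "t ^ r = t ^ (r - 1) * t" using r by (simp add: power_eq_if)
      finally have "(real r * b) * t \<le> (\<rho> * t ^ (r - 1)) * t" by simp
      then have "real r * b \<le> \<rho> * t ^ (r - 1)" using t by simp
      then show "b \<le> \<rho> * t ^ (r - 1) / r" using r by (simp add: field_simps)
    qed simp
  qed simp
  then show ?thesis using assms True by (simp add: zero_power)
next
  case False
  define h where "h = (\<lambda>t. \<rho> * t ^ r - r * b * t)"
  have "(h has_real_derivative r * (\<rho> * x ^ (r - 1) - b)) (at x)"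
    unfolding h_def by (auto intro!: derivative_eq_intros simp: algebra_simps)
  \<comment> \<open>The radius \<open>x\<close> keeps the neighbourhood inside the positive
    half-line, where \<open>min\<close> applies.\<close>
  moreover have "\<forall>y. \<bar>x - y\<bar> < x \<longrightarrow> h x \<le> h y"
    using min by (auto simp: h_def algebra_simps)
  ultimately have "r * (\<rho> * x ^ (r - 1) - b) = 0"
    using False assms(2) DERIV_local_min[of h _ x x] by (metis less_le)
  then show ?thesis using r by simp
qed

text \<open>Compactness gives a maximizer on the nonnegative part of the unit sphere. Homogeneity of
  degree \<open>r\<close> turns its maximality into an inequality for every nonnegative
  \<open>y\<close>.\<close>

lemma edge_form_attains_max:
  fixes V :: "nat set"
  assumes u: "uniform_hypergraph r V E" and r: "r \<ge> 1" and V: "V \<noteq> {}"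
  obtains x :: "nat \<Rightarrow> real" where "\<And>i. x i \<ge> 0" "(\<Sum>i\<in>V. x i ^ r) = 1"
    "\<And>y. (\<And>i. i \<in> V \<Longrightarrow> y i \<ge> 0) \<Longrightarrow> edge_form E y \<le> edge_form E x * (\<Sum>i\<in>V. y i ^ r)"
proof -
  note U = uniform_hypergraphD[OF u]
  \<comment> \<open>Vectors are functions on all natural numbers. Fixing the coordinates outside
    \<open>V\<close> at 0 makes the box compact by Tychonoff. The bound 1 excludes no nonnegative
    point of the sphere, since each \<open>x i ^ r\<close> with \<open>i\<close> in \<open>V\<close>
    is at most \<open>N x\<close>.\<close>
  define B where "B = PiE UNIV (\<lambda>i. if i \<in> V then {0..1} else {0::real})"
  have "compactin (product_topology (\<lambda>_. euclidean) UNIV) B"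
    unfolding B_def by (subst compactin_PiE) auto
  then have B: "compact B" by (simp add: euclidean_product_topology)
  define N where "N = (\<lambda>x::nat \<Rightarrow> real. \<Sum>i\<in>V. x i ^ r)"
  define S where "S = B \<inter> {x. N x = 1}"
  have contN: "continuous_on UNIV N" unfolding N_def by (intro continuous_intros continuous_on_product_coordinates)
  have "closed {x. N x = 1}"
    using contN by (intro closed_Collect_eq continuous_intros)
  then have S: "compact S" unfolding S_def using B by (rule compact_Int_closed[rotated])
  have scale: "\<exists>z\<in>S. \<forall>i\<in>V. y i = root r (N y) * z i" if y: "\<And>i. i \<in> V \<Longrightarrow> y i \<ge> 0" and N: "N y > 0" for y
  proof -
    define c where "c = root r (N y)"
    have c: "c > 0" "c ^ r = N y" using N r by (auto simp: c_def)
    define z where "z = (\<lambda>i. if i \<in> V then y i / c else 0)"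
    have "N z = N y / c ^ r" by (simp add: N_def z_def power_divide sum_divide_distrib)
    then have Nz: "N z = 1" using c N by simp
    have z0: "z i \<ge> 0" for i using y c by (simp add: z_def)
    have "z i \<le> 1" if i: "i \<in> V" for i
    proof -
      have "z i ^ r \<le> N z" unfolding N_def using U(1) z0 i by (intro member_le_sum) auto
      then have "z i ^ r \<le> 1" using Nz by simp
      then show ?thesis using r z0[of i] by (simp add: power_le_one_iff)
    qed
    then have "z \<in> S" using Nz z0 by (auto simp: S_def B_def PiE_def Pi_def) (simp add: z_def)
    moreover have "\<forall>i\<in>V. y i = c * z i" using c by (simp add: z_def)
    ultimately show ?thesis unfolding c_def by blast
  qed
  have "N (\<lambda>_. 1) > 0" using V U(1) by (simp add: N_def card_gt_0_iff)
  then have "S \<noteq> {}" using scale[of "\<lambda>_. 1"] by auto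
  moreover have "continuous_on S (edge_form E :: (nat \<Rightarrow> real) \<Rightarrow> real)"
    unfolding edge_form_def
    by (intro continuous_intros continuous_on_subset[OF continuous_on_product_coordinates]) auto
  ultimately obtain x where x: "x \<in> S" and max: "\<And>z. z \<in> S \<Longrightarrow> edge_form E z \<le> edge_form E x"
    using continuous_attains_sup[OF S] by blast
  show thesis
  proof
    show "x i \<ge> 0" for i
    proof -
      have "x i \<in> (if i \<in> V then {0..1} else {0})" using x by (auto simp: S_def B_def PiE_def Pi_def)
      then show ?thesis by (auto split: if_splits)
    qed
    show "(\<Sum>i\<in>V. x i ^ r) = 1" using x by (simp add: S_def N_def)
    fix y :: "nat \<Rightarrow> real" assume y: "\<And>i. i \<in> V \<Longrightarrow> y i \<ge> 0"
    have "N y \<ge> 0" unfolding N_def using y by (intro sum_nonneg) auto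
    then consider "N y = 0" | "N y > 0" by linarith
    then have "edge_form E y \<le> edge_form E x * N y"
    proof cases
      case 1
      then have "y i = 0" if "i \<in> V" for i
        using that y U(1) r unfolding N_def by (subst (asm) sum_nonneg_eq_0_iff) auto
      then have "edge_form E y = 0"
        unfolding edge_form_def using U by (intro sum.neutral ballI) (metis all_not_in_conv prod_zero subsetD)
      then show ?thesis using 1 by simp
    next
      case 2
      then obtain z where z: "z \<in> S" "\<forall>i\<in>V. y i = root r (N y) * z i" using scale y by blast
      have "edge_form E y = (\<Sum>e\<in>E. root r (N y) ^ r * (\<Prod>j\<in>e. z j))"
        unfolding edge_form_def
      proof (rule sum.cong[OF refl])
        fix e assume e: "e \<in> E"
        have "(\<Prod>j\<in>e. y j) = (\<Prod>j\<in>e. root r (N y) * z j)"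
          using z(2) U(4)[OF e] by (intro prod.cong) auto
        then show "(\<Prod>j\<in>e. y j) = root r (N y) ^ r * (\<Prod>j\<in>e. z j)"
          using U(5)[OF e] by (simp add: prod.distrib)
      qed
      also have "\<dots> = N y * edge_form E z"
        using 2 r by (simp add: edge_form_def sum_distrib_left)
      also have "\<dots> \<le> N y * edge_form E x" using max[OF z(1)] 2 by simp
      finally show ?thesis by (simp add: mult.commute)
    qed
    then show "edge_form E y \<le> edge_form E x * (\<Sum>i\<in>V. y i ^ r)" by (simp add: N_def)
  qed
qed

text \<open>Later estimates use the spectral radius only through these two facts: upper bounds start
  from a maximizer, lower bounds from a test vector \<open>y\<close>.\<close>

lemma hypergraph_spectral_radius_variational:
  fixes y :: "nat \<Rightarrow> real"
  assumes u: "uniform_hypergraph r {1..n} E" and r: "r \<ge> 2" and n: "n \<ge> 1"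
  shows "\<exists>x :: nat \<Rightarrow> real. (\<forall>i. x i \<ge> 0) \<and> (\<Sum>i=1..n. x i ^ r) = 1 \<and>
      hypergraph_spectral_radius r n E = r * edge_form E x"
    and "(\<And>i. i \<in> {1..n} \<Longrightarrow> y i \<ge> 0) \<Longrightarrow>
      r * edge_form E y \<le> hypergraph_spectral_radius r n E * (\<Sum>i=1..n. y i ^ r)"
proof -
  note U = uniform_hypergraphD[OF u]
  obtain x :: "nat \<Rightarrow> real" where x0: "\<And>i. x i \<ge> 0" and x1: "(\<Sum>i=1..n. x i ^ r) = 1"
    and max: "\<And>y. (\<And>i. i \<in> {1..n} \<Longrightarrow> y i \<ge> 0) \<Longrightarrow>
        edge_form E y \<le> edge_form E x * (\<Sum>i=1..n. y i ^ r)"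
    by (rule edge_form_attains_max[OF u]) (use r n in auto)
  define \<rho> where "\<rho> = r * edge_form E x"
  have rho0: "\<rho> \<ge> 0" unfolding \<rho>_def edge_form_def using x0 by (intro mult_nonneg_nonneg sum_nonneg prod_nonneg) auto
  have max': "r * edge_form E y \<le> \<rho> * (\<Sum>i=1..n. y i ^ r)" if "\<And>i. i \<in> {1..n} \<Longrightarrow> y i \<ge> 0"
    for y :: "nat \<Rightarrow> real"
    using mult_left_mono[OF max[of y, OF that], of "real r"] by (simp add: \<rho>_def mult.assoc)
  \<comment> \<open>Only the coordinate \<open>i\<close> is varied in the maximality inequality. The
    constant terms \<open>r * edge_form E x\<close> and \<open>\<rho>\<close> cancel, which leaves
    the assumption of \<open>eigen_equation_of_min\<close>.\<close>
  have eig: "link_form E x i = \<rho> * x i ^ (r - 1)" if i: "i \<in> {1..n}" for i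
  proof (rule eigen_equation_of_min[OF r x0])
    show "link_form E x i \<ge> 0" unfolding link_form_def using x0 by (intro sum_nonneg prod_nonneg) auto
    fix t :: real assume t: "t \<ge> 0"
    have "(\<Sum>j=1..n. (x(i := t)) j ^ r) = t ^ r + (\<Sum>j\<in>{1..n} - {i}. x j ^ r)"
      using i by (subst sum.remove[OF _ i]) auto
    also have "\<dots> = t ^ r + (1 - x i ^ r)"
      using x1 i by (subst (asm) sum.remove[OF _ i]) auto
    finally have "r * edge_form E (x(i := t)) \<le> \<rho> * (t ^ r + (1 - x i ^ r))"
      using max'[of "x(i := t)"] t x0 by simp
    then show "real r * link_form E x i * (t - x i) \<le> \<rho> * (t ^ r - x i ^ r)"
      unfolding edge_form_upd[OF u] by (simp add: \<rho>_def algebra_simps)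
  qed
  have "\<exists>i\<in>{1..n}. x i \<noteq> 0"
  proof (rule ccontr)
    assume "\<not> ?thesis"
    then have "(\<Sum>i=1..n. x i ^ r) = 0" using r by (intro sum.neutral) auto
    then show False using x1 by simp
  qed
  moreover have "link_form E (\<lambda>j. complex_of_real (x j)) i = complex_of_real (link_form E x i)" for i
    by (simp add: link_form_def)
  ultimately have ev: "tensor_eigenvalue r n (adjacency_tensor r E) (complex_of_real \<rho>)"
    unfolding tensor_eigenvalue_def tensor_apply_adjacency[OF u]
    by (intro exI[of _ "\<lambda>j. complex_of_real (x j)"]) (auto simp: eig)
  \<comment> \<open>For the moduli \<open>y\<close> of an eigenvector the eigenvalue equations
    become inequalities. Weighted by \<open>y i\<close> and summed, they give
    \<open>r * edge_form E y\<close> by Euler's identity, and \<open>max'\<close> applies.\<close>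
  have bound: "cmod \<mu> \<le> \<rho>" if ev\<mu>: "tensor_eigenvalue r n (adjacency_tensor r E) \<mu>" for \<mu>
  proof -
    obtain z i\<^sub>0 where z0: "i\<^sub>0 \<in> {1..n}" "z i\<^sub>0 \<noteq> 0"
      and z: "\<And>i. i \<in> {1..n} \<Longrightarrow> link_form E z i = \<mu> * z i ^ (r - 1)"
      using ev\<mu> unfolding tensor_eigenvalue_def tensor_apply_adjacency[OF u] by auto
    define y where "y = (\<lambda>i. cmod (z i))"
    have le: "cmod \<mu> * y i ^ r \<le> y i * link_form E y i" if i: "i \<in> {1..n}" for i
    proof -
      have "cmod \<mu> * y i ^ (r - 1) = cmod (link_form E z i)"
        by (simp add: z[OF i] y_def norm_mult norm_power)
      also have "\<dots> \<le> link_form E y i"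
        unfolding link_form_def y_def
        by (rule order_trans[OF norm_sum]) (simp add: prod_norm)
      finally have "y i * (cmod \<mu> * y i ^ (r - 1)) \<le> y i * link_form E y i"
        by (intro mult_left_mono) (simp_all add: y_def)
      moreover have "y i ^ r = y i * y i ^ (r - 1)" using r by (simp add: power_eq_if)
      ultimately show ?thesis by (simp add: algebra_simps)
    qed
    have "cmod \<mu> * (\<Sum>i=1..n. y i ^ r) \<le> (\<Sum>i=1..n. y i * link_form E y i)"
      unfolding sum_distrib_left by (rule sum_mono) (rule le)
    also have "\<dots> = r * edge_form E y" by (rule sum_mult_link_form[OF u])
    also have "\<dots> \<le> \<rho> * (\<Sum>i=1..n. y i ^ r)" by (rule max') (simp add: y_def)
    finally have "cmod \<mu> * (\<Sum>i=1..n. y i ^ r) \<le> \<rho> * (\<Sum>i=1..n. y i ^ r)" .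
    moreover have "(\<Sum>i=1..n. y i ^ r) > 0"
      using z0 by (intro sum_pos2[of _ i\<^sub>0]) (auto simp: y_def)
    ultimately show ?thesis by simp
  qed
  have rho: "hypergraph_spectral_radius r n E = \<rho>"
    unfolding hypergraph_spectral_radius_def tensor_spectral_radius_def
    by (rule Greatest_equality) (use ev rho0 bound in \<open>auto intro!: exI[of _ "complex_of_real \<rho>"]\<close>)
  show "\<exists>x :: nat \<Rightarrow> real. (\<forall>i. x i \<ge> 0) \<and> (\<Sum>i=1..n. x i ^ r) = 1 \<and> hypergraph_spectral_radius r n E = r * edge_form E x"
    using x0 x1 rho \<rho>_def by auto
  show "(\<And>i. i \<in> {1..n} \<Longrightarrow> y i \<ge> 0) \<Longrightarrow>
      r * edge_form E y \<le> hypergraph_spectral_radius r n E * (\<Sum>i=1..n. y i ^ r)"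
    unfolding rho by (rule max')
qed

section \<open>Propagation along walks and the degree bound\<close>

text \<open>Consecutive vertices of a walk share an edge, so the value of \<open>f\<close>
  propagates by induction on the position.\<close>

lemma connected_hypergraph_constant:
  assumes "connected_hypergraph V E"
    and edge: "\<And>e i j. e \<in> E \<Longrightarrow> i \<in> e \<Longrightarrow> j \<in> e \<Longrightarrow> f i = f j"
    and "i \<in> V" "j \<in> V"
  shows "f i = f j"
proof -
  obtain vs es where w: "hyperwalk V E vs es" and h: "hd vs = i" "last vs = j"
    using assms unfolding connected_hypergraph_def by blast
  have l: "length vs = Suc (length es)" using w by (simp add: hyperwalk_def)
  have "f (vs ! k) = f (vs ! 0)" if "k \<le> length es" for k
    using that
  proof (induction k)
    case (Suc k)
    then have "es ! k \<in> E" "vs ! k \<in> es ! k" "vs ! Suc k \<in> es ! k"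
      using w by (auto simp: hyperwalk_def)
    then show ?case using edge[of "es ! k" "vs ! k" "vs ! Suc k"] Suc by simp
  qed simp
  from this[of "length es"] have "f (vs ! length es) = f (vs ! 0)" by blast
  moreover have "vs \<noteq> []" using l by auto
  then have "vs ! 0 = i" "vs ! length es = j"
    using h l by (simp_all add: hd_conv_nth last_conv_nth)
  ultimately show ?thesis by simp
qed

theorem theorem1p1:
  fixes r n :: nat and E :: "nat set set"
  assumes "r \<ge> 3" and "n \<ge> 1"
    and "uniform_hypergraph r {1..n} E"
  shows "hypergraph_spectral_radius r n E \<ge>
           ((1 / real n) * (\<Sum>i=1..n. real (hyperdegree E i) powr (real r / (real r - 1))))
             powr ((real r - 1) / real r)
       \<and> (connected_hypergraph {1..n} E \<longrightarrow>
           (hypergraph_spectral_radius r n E =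
              ((1 / real n) * (\<Sum>i=1..n. real (hyperdegree E i) powr (real r / (real r - 1))))
                powr ((real r - 1) / real r)
            \<longleftrightarrow> regular_hypergraph {1..n} E))"
proof -
  note U = uniform_hypergraphD[OF assms(3)]
  have r2: "r \<ge> 2" and r1: "r \<ge> 1" using assms(1) by auto
  define q where "q = real r / (real r - 1)"
  define D where "D = (\<Sum>i=1..n. real (hyperdegree E i) powr q)"
  define \<rho> where "\<rho> = hypergraph_spectral_radius r n E"
  define \<beta> where "\<beta> = ((1 / real n) * D) powr ((real r - 1) / real r)"
  note rho = hypergraph_spectral_radius_variational[OF assms(3) r2 assms(2), folded \<rho>_def]
  have q: "q > 0" using r2 by (simp add: q_def)
  have D0: "D \<ge> 0" unfolding D_def by (intro sum_nonneg) auto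
  have rho0: "\<rho> \<ge> 0"
  proof -
    obtain x :: "nat \<Rightarrow> real" where "\<And>i. x i \<ge> 0" "\<rho> = r * edge_form E x" using rho(1) by blast
    then show ?thesis by (auto simp: edge_form_def intro!: mult_nonneg_nonneg sum_nonneg prod_nonneg)
  qed
  have main: "\<beta> \<le> \<rho> \<and> (connected_hypergraph {1..n} E \<longrightarrow> \<rho> = \<beta> \<longrightarrow> regular_hypergraph {1..n} E)"
  proof (cases "D = 0")
    \<comment> \<open>All degrees vanish, so the hypergraph is regular, and \<open>\<beta>\<close>
      is 0 because \<open>0 powr a = 0\<close>.\<close>
    case True
    then have "hyperdegree E i = 0" if "i \<in> {1..n}" for i
      using that unfolding D_def by (subst (asm) sum_nonneg_eq_0_iff) auto
    then show ?thesis using True rho0 by (simp add: \<beta>_def regular_hypergraph_def)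
  next
    case False
    then have D: "D > 0" using D0 by simp
    \<comment> \<open>The factor \<open>c\<close> gives the \<open>w i ^ r\<close> the sum
      \<open>n\<close>. The exponent \<open>1 / (r - 1)\<close> in \<open>w\<close> makes both
      \<open>w i ^ r\<close> and \<open>hyperdegree E i * w i\<close> multiples of
      \<open>hyperdegree E i powr q\<close>.\<close>
    define c where "c = (real n / D) powr (1 / r)"
    have c: "c > 0" using D assms(2) by (simp add: c_def)
    have cr: "c ^ r = n / D" using c D assms(2) r2 by (simp add: c_def powr_powr flip: powr_realpow)
    define w where "w = (\<lambda>i. c * real (hyperdegree E i) powr (1 / (real r - 1)))"
    have w0: "w i \<ge> 0" for i using c by (simp add: w_def)
    define x where "x = (\<lambda>i. root r (w i ^ r + real (r - 1)))"
    have x0: "x i > 0" for i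
      unfolding x_def using w0[of i] r2 by (intro real_root_gt_zero add_nonneg_pos) auto
    \<comment> \<open>Degree 0 is treated apart because turning \<open>powr\<close> into a natural
      power needs a positive base.\<close>
    have wr: "w i ^ r = c ^ r * real (hyperdegree E i) powr q" for i
      using r2 by (cases "hyperdegree E i = 0")
        (simp_all add: w_def q_def power_mult_distrib powr_powr zero_power flip: powr_realpow)
    have "(\<Sum>i=1..n. w i ^ r) = c ^ r * D" by (simp add: wr D_def sum_distrib_left)
    then have sw: "(\<Sum>i=1..n. w i ^ r) = n" using D by (simp add: cr)
    have xr: "x i ^ r = w i ^ r + real (r - 1)" for i
      unfolding x_def using w0[of i] r2 by (intro real_root_pow_pos2) auto
    have sx: "(\<Sum>i=1..n. x i ^ r) = real r * real n"
    proof -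
      have "(\<Sum>i=1..n. x i ^ r) = real n + real n * real (r - 1)"
        unfolding xr sum.distrib sw by simp
      then show ?thesis using r2 by (simp add: of_nat_diff algebra_simps)
    qed
    have wd: "hyperdegree E i * w i = c * real (hyperdegree E i) powr q" for i
    proof -
      have "q = 1 + 1 / (real r - 1)" using r2 by (simp add: q_def field_simps)
      then show ?thesis by (cases "hyperdegree E i = 0") (auto simp: w_def powr_add)
    qed
    have sdw: "(\<Sum>e\<in>E. \<Sum>i\<in>e. w i) = c * D"
      using sum_degree[OF assms(3), of w] by (simp add: wd D_def sum_distrib_left)
    have xe: "x k = root (card e) (w k ^ card e + real (card e - 1))" if "e \<in> E" for e k
      using U(5)[OF that] by (simp add: x_def)
    have edge: "(\<Sum>i\<in>e. w i) \<le> (\<Prod>i\<in>e. x i)" if e: "e \<in> E" for e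
      by (rule sum_le_prod_root(1)[OF U(3)[OF e] _ w0 xe[OF e]]) (use U(5)[OF e] r2 in simp)
    have edge_eq: "x i = x j" if e: "e \<in> E" and "(\<Sum>i\<in>e. w i) = (\<Prod>i\<in>e. x i)" "i \<in> e" "j \<in> e" for e i j
      by (rule sum_le_prod_root(2)[OF U(3)[OF e] _ w0 xe[OF e] that(2) _ that(3,4)])
        (use U(5)[OF e] assms(1) in simp_all)
    \<comment> \<open>The bound is the chain
      \<open>\<beta> * n = c * D \<le> edge_form E x \<le> \<rho> * n\<close>. If its ends agree,
      the inequality is tight on every edge.\<close>
    have le1: "c * D \<le> edge_form E x"
      unfolding edge_form_def sdw[symmetric] by (rule sum_mono) (rule edge)
    have "r * edge_form E x \<le> \<rho> * (real r * real n)"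
      using rho(2)[of x] x0 sx by (simp add: less_imp_le)
    then have le2: "edge_form E x \<le> \<rho> * n" using r2 by (simp add: mult.left_commute)
    \<comment> \<open>Both sides are \<open>n powr (1 / r) * D powr (1 - 1 / r)\<close>.\<close>
    have cD: "c * D = \<beta> * n"
    proof -
      define a where "a = real n / D"
      have a: "a > 0" using D assms(2) by (simp add: a_def)
      have "\<beta> = (inverse a) powr (1 - 1 / r)"
        using r2 by (simp add: \<beta>_def a_def diff_divide_distrib)
      also have "\<dots> = a powr (1 / r - 1)"
        using a by (metis minus_diff_eq powr_minus inverse_powr less_imp_le)
      also have "\<dots> = c / a" using a D by (simp add: powr_diff c_def a_def)
      finally show ?thesis using D assms(2) by (simp add: a_def)
    qed
    have "\<beta> * n \<le> \<rho> * n" using le1 le2 cD by linarith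
    then have "\<beta> \<le> \<rho>" using assms(2) by simp
    moreover have "regular_hypergraph {1..n} E" if conn: "connected_hypergraph {1..n} E" and eq: "\<rho> = \<beta>"
    proof -
      have "edge_form E x = c * D" using le1 le2 cD eq by simp
      then have tight: "(\<Sum>e\<in>E. \<Sum>i\<in>e. w i) = (\<Sum>e\<in>E. \<Prod>i\<in>e. x i)"
        by (simp add: sdw edge_form_def)
      have "x i = x j" if "e \<in> E" "i \<in> e" "j \<in> e" for e i j
        by (rule edge_eq[OF that(1) sum_mono_inv[OF tight _ that(1) U(2)] that(2,3)]) (rule edge)
      then have const: "x i = x j" if "i \<in> {1..n}" "j \<in> {1..n}" for i j
        using connected_hypergraph_constant[OF conn, of x] that by blast
      show ?thesis
        unfolding regular_hypergraph_def
      proof (intro ballI)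
        fix i j assume "i \<in> {1..n}" "j \<in> {1..n}"
        then have "w i ^ r = w j ^ r" using const xr by (metis add_right_cancel)
        then have "real (hyperdegree E i) powr q = real (hyperdegree E j) powr q"
          using c by (simp add: wr)
        then have "(real (hyperdegree E i) powr q) powr (1 / q) = (real (hyperdegree E j) powr q) powr (1 / q)"
          by (rule arg_cong)
        then show "hyperdegree E i = hyperdegree E j"
          using q by (simp add: powr_powr)
      qed
    qed
    ultimately show ?thesis by blast
  qed
  have "\<rho> \<le> \<beta>" if reg: "regular_hypergraph {1..n} E"
  proof -
    define d where "d = hyperdegree E 1"
    have "1 \<in> {1..n}" using assms(2) by simp
    then have d: "hyperdegree E i = d" if "i \<in> {1..n}" for i
      using reg that unfolding regular_hypergraph_def d_def by blast
    have "D = n * real d powr q" by (simp add: D_def d)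
    then have \<beta>: "\<beta> = d"
      using assms(2) r2 by (simp add: \<beta>_def powr_powr q_def)
    obtain x :: "nat \<Rightarrow> real" where x: "\<And>i. x i \<ge> 0" "(\<Sum>i=1..n. x i ^ r) = 1"
      and \<rho>: "\<rho> = r * edge_form E x" using rho(1) by blast
    \<comment> \<open>AM-GM on each edge, then counting each vertex with its degree
      \<open>d\<close>, bounds the maximum by \<open>d\<close>, as the \<open>x i ^ r\<close> sum to
      1.\<close>
    have "\<rho> = (\<Sum>e\<in>E. r * (\<Prod>j\<in>e. x j))" by (simp add: \<rho> edge_form_def sum_distrib_left)
    also have "\<dots> \<le> (\<Sum>e\<in>E. \<Sum>j\<in>e. x j ^ r)"
    proof (rule sum_mono)
      fix e assume e: "e \<in> E"
      show "r * (\<Prod>j\<in>e. x j) \<le> (\<Sum>j\<in>e. x j ^ r)"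
        using card_times_prod_le_sum_power(1)[OF U(3)[OF e] U(6)[OF e] x(1)] unfolding U(5)[OF e] .
    qed
    also have "\<dots> = (\<Sum>i=1..n. hyperdegree E i * x i ^ r)"
      by (rule sum_degree[OF assms(3), symmetric])
    also have "\<dots> = d" using x(2) by (simp add: d flip: sum_distrib_left)
    finally show ?thesis by (simp add: \<beta>)
  qed
  then have "\<beta> \<le> \<rho> \<and> (connected_hypergraph {1..n} E \<longrightarrow> (\<rho> = \<beta> \<longleftrightarrow> regular_hypergraph {1..n} E))"
    using main by (auto intro: antisym)
  then show ?thesis unfolding \<rho>_def \<beta>_def D_def q_def .
qed

end
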